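(* Let $m,n\ge 1$ be integers, let $\Omega\subset\mathbb{C}^m$ be a domain, let $\mathcal{H}$ be a complex separable Hilbert space, and let $\mathbf{T}=(T_1,\dots,T_m)$ be a commuting $m$-tuple of bounded linear operators on $\mathcal{H}$ belonging to the Cowen-Douglas class $\mathcal{B}_n^m(\Omega)$. Then $\mathbf{T}$ is cyclic, i.e. there exists a vector $f\in\mathcal{H}$ such that the closed linear span of $\{\mathbf{T}^\alpha f:\alpha\in\mathbb{Z}_+^m\}$ equals $\mathcal{H}$.
   Context: A domain in $\mathbb{C}^m$ is an open and connected set. $\mathbb{Z}_+^m$ is the set of $m$-tuples of nonnegative integers, and for $\alpha=(\alpha_1,\dots,\alpha_m)\in\mathbb{Z}_+^m$ one writes $\mathbf{T}^\alpha=T_1^{\alpha_1}\cdots T_m^{\alpha_m}$. For a commuting $m$-tuple $\mathbf{T}=(T_1,\dots,T_m)$ of bounded linear operators on $\mathcal{H}$ and $w=(w_1,\dots,w_m)\in\mathbb{C}^m$, define the bounded linear map $\mathscr{D}_{\mathbf{T}-w}:\mathcal{H}\to\mathcal{H}\oplus\cdots\oplus\mathcal{H}$ ($m$ copies) by $\mathscr{D}_{\mathbf{T}-w}h=((T_1-w_1)h,\dots,(T_m-w_m)h)$, so that $\ker\mathscr{D}_{\mathbf{T}-w}=\bigcap_{i=1}^m\ker(T_i-w_i)$. The Cowen-Douglas class $\mathcal{B}_n^m(\Omega)$ consists of the commuting $m$-tuples $\mathbf{T}$ of bounded linear operators on $\mathcal{H}$ such that: (i) the range of $\mathscr{D}_{\mathbf{T}-w}$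 is closed for all $w\in\Omega$; (ii) $\dim\ker\mathscr{D}_{\mathbf{T}-w}=n$ for all $w\in\Omega$; (iii) the closed linear span of $\bigcup_{w\in\Omega}\ker\mathscr{D}_{\mathbf{T}-w}$ is $\mathcal{H}$. *)

theory Defs
  imports "HOL-Analysis.Analysis"
begin

section \<open>Complex Hilbert spaces\<close>

text \<open>
  A complex Hilbert space carries the real inner product \<open>Re \<langle>x, y\<rangle>\<close>, which
  induces the same norm. Building on \<^class>\<open>real_inner\<close> and \<^class>\<open>complete_space\<close>
  therefore excludes no complex Hilbert space. Positive definiteness of \<open>cinner\<close> and
  \<open>norm x = sqrt (cinner x x)\<close> follow from \<^class>\<open>real_inner\<close>; see
  \<open>cinner_same\<close> below. The inner product is linear in the first argument.
\<close>

class chilbert_space = real_inner + complete_space +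
  fixes scaleC :: "complex \<Rightarrow> 'a \<Rightarrow> 'a" (infixr \<open>*\<^sub>C\<close> 75)
    and cinner :: "'a \<Rightarrow> 'a \<Rightarrow> complex"
  assumes scaleC_add_right: "c *\<^sub>C (x + y) = c *\<^sub>C x + c *\<^sub>C y"
    and scaleC_add_left: "(c + d) *\<^sub>C x = c *\<^sub>C x + d *\<^sub>C x"
    and scaleC_scaleC: "c *\<^sub>C d *\<^sub>C x = (c * d) *\<^sub>C x"
    and scaleC_of_real: "complex_of_real r *\<^sub>C x = r *\<^sub>R x"
    and cinner_commute: "cinner x y = cnj (cinner y x)"
    and cinner_add_left: "cinner (x + y) z = cinner x z + cinner y z"
    and cinner_scaleC_left: "cinner (c *\<^sub>C x) y = c * cinner x y"
    and inner_eq_Re_cinner: "inner x y = Re (cinner x y)"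

lemma cinner_same:
  fixes x :: "'a::chilbert_space"
  shows "cinner x x = complex_of_real ((norm x)\<^sup>2)"
proof -
  have "Im (cinner x x) = 0"
    using cinner_commute[of x x] by (simp add: complex_eq_iff)
  moreover have "Re (cinner x x) = (norm x)\<^sup>2"
    by (simp add: inner_eq_Re_cinner[symmetric] dot_square_norm)
  ultimately show ?thesis
    by (simp add: complex_eq_iff)
qed

global_interpretation complex_vector: vector_space "scaleC :: complex \<Rightarrow> 'a \<Rightarrow> 'a::chilbert_space"
proof
  show "1 *\<^sub>C x = x" for x :: 'a
    using scaleC_of_real[of 1 x] by simp
qed (simp_all add: scaleC_add_right scaleC_add_left scaleC_scaleC)

instantiation complex :: chilbert_space
begin

definition scaleC_complex :: "complex \<Rightarrow> complex \<Rightarrow> complex"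
  where "scaleC_complex c x = c * x"

definition cinner_complex :: "complex \<Rightarrow> complex \<Rightarrow> complex"
  where "cinner_complex x y = x * cnj y"

instance
  by standard
    (simp_all add: scaleC_complex_def cinner_complex_def inner_complex_def algebra_simps
      scaleR_conv_of_real)

end

section \<open>Operator tuples and the Cowen--Douglas class\<close>

definition bounded_clinear :: "('a::chilbert_space \<Rightarrow> 'a) \<Rightarrow> bool"
  where "bounded_clinear A \<longleftrightarrow> bounded_linear A \<and> (\<forall>c x. A (c *\<^sub>C x) = c *\<^sub>C A x)"

definition commuting_tuple :: "('m::finite \<Rightarrow> 'a::chilbert_space \<Rightarrow> 'a) \<Rightarrow> bool"
  where "commuting_tuple T \<longleftrightarrow>
    (\<forall>i. bounded_clinear (T i)) \<and> (\<forall>i j. T i \<circ> T j = T j \<circ> T i)"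

text \<open>
  The vector \<open>T\<^sup>\<alpha> f\<close>. The fold applies \<open>T i ^^ \<alpha> i\<close> once for every index
  \<open>i\<close>; for commuting tuples the order is irrelevant (see \<open>tuple_power_upd\<close>).
\<close>

definition tuple_power :: "('m::finite \<Rightarrow> 'a \<Rightarrow> 'a) \<Rightarrow> ('m \<Rightarrow> nat) \<Rightarrow> 'a \<Rightarrow> 'a"
  where "tuple_power T \<alpha> f = Finite_Set.fold (\<lambda>i. T i ^^ \<alpha> i) f UNIV"

text \<open>The codomain \<^typ>\<open>'a ^ 'm\<close> carries the \<open>\<ell>\<^sup>2\<close> norm, i.e. it is the Hilbert direct sum.\<close>

definition tuple_map ::
    "('m::finite \<Rightarrow> 'a::chilbert_space \<Rightarrow> 'a) \<Rightarrow> complex ^ 'm \<Rightarrow> 'a \<Rightarrow> 'a ^ 'm"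
  where "tuple_map T w h = (\<chi> i. T i h - (w $ i) *\<^sub>C h)"

definition tuple_kernel ::
    "('m::finite \<Rightarrow> 'a::chilbert_space \<Rightarrow> 'a) \<Rightarrow> complex ^ 'm \<Rightarrow> 'a set"
  where "tuple_kernel T w = {h. tuple_map T w h = 0}"

text \<open>
  The library's dimension of an infinite-dimensional space is 0, so the dimension condition
  has its intended meaning for \<open>n \<ge> 1\<close>.
\<close>

definition cowen_douglas ::
    "nat \<Rightarrow> (complex ^ 'm) set \<Rightarrow> ('m::finite \<Rightarrow> 'a::chilbert_space \<Rightarrow> 'a) \<Rightarrow> bool"
  where "cowen_douglas n \<Omega> T \<longleftrightarrow>
    commuting_tuple T \<and>
    (\<forall>w\<in>\<Omega>. closed (range (tuple_map T w))) \<and>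
    (\<forall>w\<in>\<Omega>. complex_vector.dim (tuple_kernel T w) = n) \<and>
    closure (complex_vector.span (\<Union>w\<in>\<Omega>. tuple_kernel T w)) = UNIV"

definition cyclic_tuple :: "('m::finite \<Rightarrow> 'a::chilbert_space \<Rightarrow> 'a) \<Rightarrow> bool"
  where "cyclic_tuple T \<longleftrightarrow>
    (\<exists>f. closure (complex_vector.span (range (\<lambda>\<alpha>. tuple_power T \<alpha> f))) = UNIV)"

lemma tuple_kernel_eq: "tuple_kernel T w = (\<Inter>i. {h. T i h - (w $ i) *\<^sub>C h = 0})"
  by (auto simp: tuple_kernel_def tuple_map_def vec_eq_iff)

lemma commuting_tuple_comp_fun_commute:
  assumes "commuting_tuple T"
  shows "comp_fun_commute (\<lambda>i. T i ^^ \<alpha> i)"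
proof -
  interpret comp_fun_commute T
    using assms by unfold_locales (auto simp: commuting_tuple_def)
  show ?thesis
    by (rule comp_fun_commute_funpow)
qed

lemma tuple_power_zero [simp]: "tuple_power T (\<lambda>_. 0) f = f"
proof -
  interpret comp_fun_commute "\<lambda>i. T i ^^ 0"
    by unfold_locales simp
  have "Finite_Set.fold (\<lambda>i. T i ^^ 0) f A = f" if "finite A" for A
    using that
  proof induction
    case (insert x A)
    then show ?case
      by (subst fold_insert) (simp_all add: id_def)
  qed simp
  then show ?thesis
    by (simp add: tuple_power_def)
qed

lemma tuple_power_upd:
  assumes "commuting_tuple T"
  shows "tuple_power T (\<alpha>(i := Suc (\<alpha> i))) f = T i (tuple_power T \<alpha> f)"
proof -
  let ?\<beta> = "\<alpha>(i := Suc (\<alpha> i))"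
  interpret A: comp_fun_commute "\<lambda>j. T j ^^ \<alpha> j"
    using assms by (rule commuting_tuple_comp_fun_commute)
  interpret B: comp_fun_commute "\<lambda>j. T j ^^ ?\<beta> j"
    using assms by (rule commuting_tuple_comp_fun_commute)
  have eq: "Finite_Set.fold (\<lambda>j. T j ^^ ?\<beta> j) f (UNIV - {i}) =
      Finite_Set.fold (\<lambda>j. T j ^^ \<alpha> j) f (UNIV - {i})"
    by (rule fold_closed_eq[where B = UNIV]) auto
  have "tuple_power T ?\<beta> f = (T i ^^ ?\<beta> i) (Finite_Set.fold (\<lambda>j. T j ^^ ?\<beta> j) f (UNIV - {i}))"
    unfolding tuple_power_def by (rule B.fold_rec) auto
  also have "\<dots> = T i ((T i ^^ \<alpha> i) (Finite_Set.fold (\<lambda>j. T j ^^ \<alpha> j) f (UNIV - {i})))"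
    unfolding eq by simp
  also have "(T i ^^ \<alpha> i) (Finite_Set.fold (\<lambda>j. T j ^^ \<alpha> j) f (UNIV - {i})) = tuple_power T \<alpha> f"
    unfolding tuple_power_def by (rule A.fold_rec[symmetric]) auto
  finally show ?thesis .
qed

end

theory Submission
  imports Defs
begin

text \<open>
  Suppose \<open>e\<^sub>k\<close> are joint eigenvectors with pairwise \<^emph>\<open>distinct\<close> joint eigenvalues \<open>w\<^sub>k\<close> and put
  \<open>f = \<Sum>k. c\<^sub>k e\<^sub>k\<close>. Products of factors \<open>(T\<^sub>i - w\<^sub>j\<^sub>i) / (w\<^sub>k\<^sub>i - w\<^sub>j\<^sub>i)\<close> give polynomials in \<open>T\<close> that
  fix \<open>e\<^sub>k\<close> and kill all other \<open>e\<^sub>j\<close> with \<open>j \<le> N\<close>; if the \<open>c\<^sub>j\<close> decay fast enough compared with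
  their norms, applying them to \<open>f\<close> yields \<open>c\<^sub>k e\<^sub>k\<close> in the limit \<open>N \<rightarrow> \<infinity>\<close>. So the cyclic subspace of
  \<open>f\<close> contains every \<open>e\<^sub>k\<close>, and it remains to approximate all joint eigenvectors by such a sequence.

  This is possible because \<open>w \<mapsto> ker (T - w)\<close> is lower semicontinuous on \<open>\<Omega>\<close>, so that each eigenvector
  can be perturbed to one with an unused eigenvalue. Closedness of the range of \<open>T - w\<^sub>0\<close> gives, by the
  open mapping theorem, that \<open>ker (T - w)\<close> lies close to \<open>ker (T - w\<^sub>0)\<close> for \<open>w\<close> near \<open>w\<^sub>0\<close>, and the
  equality of the dimensions makes this relation symmetric.
\<close>

section \<open>Quantitative open mapping for operators with closed range\<close>

instance chilbert_space \<subseteq> banach ..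

text \<open>A closed range is completely metrizable, so the Baire theorem applies inside it and
  yields approximate preimages with controlled norm. Successive correction of the residual then
  turns them into an exact preimage.\<close>

lemma open_mapping_closed_range:
  fixes A :: "'a::banach \<Rightarrow> 'b::banach"
  assumes A: "bounded_linear A" and cl: "closed (range A)"
  obtains C where "C > 0" "\<And>x. \<exists>u. A u = A x \<and> norm u \<le> C * norm (A x)"
proof -
  interpret A: bounded_linear A by (rule A)
  define S where "S = range A"
  define G where "G n = closure (A ` cball 0 (real n))" for n
  have S0: "0 \<in> S" unfolding S_def using A.zero by (metis rangeI)
  have Sdiff: "x - y \<in> S" if "x \<in> S" "y \<in> S" for x y
    using that unfolding S_def by (auto simp flip: A.diff)
  have Sscale: "c *\<^sub>R x \<in> S" if "x \<in> S" for c x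
    using that unfolding S_def by (auto simp flip: A.scaleR)
  have GS: "G n \<subseteq> S" for n
    unfolding G_def S_def using cl by (intro closure_minimal) auto
  have "S \<subseteq> \<Union>(range G)"
  proof
    fix y assume "y \<in> S"
    then obtain x where x: "y = A x" by (auto simp: S_def)
    obtain n where "norm x \<le> real n" using real_arch_simple by blast
    then have "y \<in> G n" unfolding G_def x by (intro closure_subset[THEN subsetD]) auto
    then show "y \<in> \<Union>(range G)" by blast
  qed
  then have UG: "\<Union>(range G) = S" using GS by blast
  have cm: "completely_metrizable_space (top_of_set S)"
    using cl by (auto simp: S_def intro!: completely_metrizable_space_closedin[OF completely_metrizable_space_euclidean])
  have "\<exists>n. top_of_set S interior_of G n \<noteq> {}"
  proof (rule ccontr)
    assume nex: "\<not> ?thesis"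
    have "top_of_set S interior_of \<Union>(range G) = {}"
    proof (intro Baire_category_alt)
      show "completely_metrizable_space (top_of_set S) \<or>
          locally_compact_space (top_of_set S) \<and> regular_space (top_of_set S)"
        using cm by blast
      have "closedin (top_of_set S) (G n)" for n
        using GS[of n] by (intro closed_subset) (auto simp: G_def)
      then show "closedin (top_of_set S) X \<and> top_of_set S interior_of X = {}"
        if "X \<in> range G" for X
        using that nex by auto
    qed simp
    moreover have "top_of_set S interior_of S = S"
      using interior_of_topspace[of "top_of_set S"] by simp
    ultimately show False
      using UG S0 by auto
  qed
  then obtain n y0 where "y0 \<in> top_of_set S interior_of G n" by blast
  then obtain U where U: "openin (top_of_set S) U" "y0 \<in> U" "U \<subseteq> G n"
    by (auto simp: interior_of_def)
  then obtain r where r: "r > 0" "ball y0 r \<inter> S \<subseteq> U"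
    by (meson openin_contains_ball)
  have y0: "y0 \<in> G n" "y0 \<in> S" using U GS by auto
  have near: "\<exists>x. norm x \<le> real n \<and> dist (A x) y < e / 2" if "y \<in> G n" "e > 0" for y e
  proof -
    have "\<exists>z\<in>A ` cball 0 (real n). dist z y < e / 2"
      using that half_gt_zero[of e] by (simp only: G_def closure_approachable)
    then show ?thesis by auto
  qed
  \<comment> \<open>Both \<open>y0\<close> and \<open>y0 + y\<close> are limits of images of the
    ball of radius \<open>n\<close>; subtracting their approximate preimages moves the centre to 0
    and doubles the radius.\<close>
  have approx: "\<exists>x. norm x \<le> 2 * real n \<and> norm (y - A x) < e"
    if y: "y \<in> S" "norm y < r" and e: "e > 0" for y e
  proof -
    have "y0 - (0 - y) \<in> S" using Sdiff S0 y0 y by metis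
    moreover have "y0 + y \<in> ball y0 r" using y by (simp add: dist_norm)
    ultimately have "y0 + y \<in> G n" using r U by auto
    then obtain x1 where x1: "norm x1 \<le> real n" "dist (A x1) (y0 + y) < e / 2"
      using near e by blast
    obtain x2 where x2: "norm x2 \<le> real n" "dist (A x2) y0 < e / 2"
      using near e y0 by blast
    have "norm (x1 - x2) \<le> 2 * real n" using x1 x2 norm_triangle_ineq4[of x1 x2] by simp
    moreover have "norm (y - A (x1 - x2)) < e"
    proof -
      have "y - A (x1 - x2) = (A x2 - y0) - (A x1 - (y0 + y))" by (simp add: A.diff)
      then have "norm (y - A (x1 - x2)) \<le> norm (A x2 - y0) + norm (A x1 - (y0 + y))"
        by (metis norm_triangle_ineq4)
      then show ?thesis using x1 x2 by (simp add: dist_norm)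
    qed
    ultimately show ?thesis by blast
  qed
  \<comment> \<open>Scaling \<open>y\<close> to norm \<open>r / 2\<close> and back multiplies the
    radius \<open>2 * n\<close> by \<open>2 * norm y / r\<close>, hence \<open>4 * n / r\<close>;
    the extra 1 keeps \<open>K\<close> positive if \<open>n = 0\<close>. The same scaling turns the
    error \<open>r / 4\<close> into \<open>norm y / 2\<close>.\<close>
  define K where "K = (4 * real n + 1) / r"
  have K: "K > 0" using r by (auto simp: K_def intro!: divide_pos_pos)
  have half: "\<exists>x. norm x \<le> K * norm y \<and> norm (y - A x) \<le> norm y / 2" if y: "y \<in> S" for y
  proof (cases "y = 0")
    case True
    then show ?thesis by (intro exI[of _ 0]) (simp add: A.zero)
  next
    case False
    define t where "t = r / (2 * norm y)"
    have t: "t > 0" using r False by (simp add: t_def)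
    have "norm (t *\<^sub>R y) < r" using t r False by (simp add: t_def)
    with approx[OF Sscale[OF y], of t "r / 4"] r obtain x
      where x: "norm x \<le> 2 * real n" "norm (t *\<^sub>R y - A x) < r / 4" by auto
    have "norm (x /\<^sub>R t) \<le> K * norm y"
    proof -
      have "norm (x /\<^sub>R t) = norm x / t" using t by (simp add: field_simps)
      also have "\<dots> \<le> (2 * real n) / t" using x t by (intro divide_right_mono) auto
      also have "\<dots> = (4 * real n) / r * norm y" using r False by (simp add: t_def field_simps)
      also have "\<dots> \<le> K * norm y" unfolding K_def using r
        by (intro mult_right_mono divide_right_mono) auto
      finally show ?thesis .
    qed
    moreover have "norm (y - A (x /\<^sub>R t)) \<le> norm y / 2"
    proof -
      have "y - A (x /\<^sub>R t) = (t *\<^sub>R y - A x) /\<^sub>R t"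
        using t by (simp add: A.scaleR scaleR_right_diff_distrib)
      then have "norm (y - A (x /\<^sub>R t)) = norm (t *\<^sub>R y - A x) / t"
        using t by (simp add: divide_inverse mult.commute)
      also have "\<dots> \<le> (r / 4) / t" using x t by (intro divide_right_mono) auto
      also have "\<dots> = norm y / 2" using r False by (simp add: t_def field_simps)
      finally show ?thesis .
    qed
    ultimately show ?thesis by blast
  qed
  then obtain g where g: "\<And>y. y \<in> S \<Longrightarrow> norm (g y) \<le> K * norm y"
    "\<And>y. y \<in> S \<Longrightarrow> norm (y - A (g y)) \<le> norm y / 2" by metis
  show thesis
  proof
    show "2 * K > 0" using K by simp
  next
    fix x
    \<comment> \<open>\<open>Y k\<close> is the residual after \<open>k\<close> corrections. It
      halves each time, so the corrections \<open>g (Y k)\<close> sum to a preimage of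
      \<open>A x\<close>, and the geometric series accounts for the factor 2 in
      \<open>2 * K\<close>.\<close>
    define Y where "Y k = ((\<lambda>y. y - A (g y)) ^^ k) (A x)" for k
    have Y0: "Y 0 = A x" and YS: "Y (Suc k) = Y k - A (g (Y k))" for k
      by (simp_all add: Y_def)
    have YinS: "Y k \<in> S" for k
      by (induction k) (auto simp: Y0 YS S_def intro!: Sdiff[unfolded S_def])
    have Yn: "norm (Y k) \<le> norm (A x) * (1/2) ^ k" for k
    proof (induction k)
      case (Suc k)
      then show ?case using g(2)[OF YinS[of k]] by (simp add: YS)
    qed (simp add: Y0)
    have gn: "norm (g (Y k)) \<le> K * norm (A x) * (1/2) ^ k" for k
      using g(1)[OF YinS[of k]] Yn[of k] K
      by (smt (verit) mult.assoc mult_left_mono)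
    have geo: "(\<lambda>k. K * norm (A x) * (1/2) ^ k) sums (K * norm (A x) * 2)"
      using geometric_sums[of "1/2::real"] by (intro sums_mult) simp
    have summ: "summable (\<lambda>k. norm (g (Y k)))"
      by (rule summable_comparison_test'[OF sums_summable[OF geo]]) (use gn in simp)
    define u where "u = (\<Sum>k. g (Y k))"
    have "norm u \<le> (\<Sum>k. norm (g (Y k)))"
      unfolding u_def by (rule summable_norm[OF summ])
    also have "\<dots> \<le> K * norm (A x) * 2"
      using suminf_le[OF gn summ sums_summable[OF geo]] sums_unique[OF geo] by simp
    finally have nu: "norm u \<le> 2 * K * norm (A x)" by simp
    have "(\<lambda>k. g (Y k)) sums u"
      unfolding u_def by (rule summable_sums[OF summable_norm_cancel[OF summ]])
    then have "(\<lambda>k. A (g (Y k))) sums A u" by (rule A.sums)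
    moreover have "Y \<longlonglongrightarrow> 0"
    proof (rule Lim_null_comparison)
      show "\<forall>\<^sub>F k in sequentially. norm (Y k) \<le> norm (A x) * (1/2) ^ k" using Yn by simp
      show "(\<lambda>k. norm (A x) * (1/2) ^ k) \<longlonglongrightarrow> 0"
        by (intro tendsto_mult_right_zero LIMSEQ_realpow_zero) auto
    qed
    from telescope_sums'[OF this] have "(\<lambda>k. A (g (Y k))) sums A x"
      by (simp add: YS Y0)
    ultimately have "A u = A x" by (metis sums_unique2)
    with nu show "\<exists>u. A u = A x \<and> norm u \<le> 2 * K * norm (A x)" by blast
  qed
qed

section \<open>Finite-dimensional projections and the gap between subspaces\<close>

lemma norm_scaleC: "norm (c *\<^sub>C x) = cmod c * norm (x::'a::chilbert_space)"
proof -
  have "complex_of_real ((norm (c *\<^sub>C x))\<^sup>2) = c * cnj (c * cinner x x)"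
    by (metis cinner_same cinner_commute cinner_scaleC_left)
  also have "\<dots> = (c * cnj c) * cnj (cinner x x)" by simp
  also have "\<dots> = complex_of_real ((cmod c * norm x)\<^sup>2)"
    by (simp add: cinner_same complex_norm_square[symmetric] power_mult_distrib)
  finally have "(norm (c *\<^sub>C x))\<^sup>2 = (cmod c * norm x)\<^sup>2" by (simp only: of_real_eq_iff)
  then show ?thesis by (simp add: power2_eq_iff_nonneg)
qed

lemma bounded_linear_scaleC: "bounded_linear (\<lambda>x. c *\<^sub>C x :: 'a::chilbert_space)"
proof (rule bounded_linear_intro)
  show "c *\<^sub>C (r *\<^sub>R x) = r *\<^sub>R (c *\<^sub>C x)" for r and x :: 'a
    by (simp flip: scaleC_of_real add: scaleC_scaleC mult.commute)
  show "norm (c *\<^sub>C x) \<le> norm x * cmod c" for x :: 'a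
    by (simp add: norm_scaleC mult.commute)
qed (simp add: scaleC_add_right)

lemma cinner_add_right: "cinner x (y + z) = cinner x y + cinner x z"
  by (metis cinner_commute cinner_add_left complex_cnj_add)

lemma cinner_scaleC_right: "cinner x (c *\<^sub>C y) = cnj c * cinner x y"
  by (metis cinner_commute cinner_scaleC_left complex_cnj_mult)

lemma cinner_zero_left [simp]: "cinner 0 x = 0"
  using cinner_add_left[of 0 0 x] by simp

lemma cinner_diff_left: "cinner (x - y) z = cinner x z - cinner y z"
  using cinner_add_left[of "x - y" y z] by simp

text \<open>Gram-Schmidt: removing from the new vector \<open>b\<close> its projection
  \<open>q\<close> leaves \<open>e\<close> orthogonal to the old span, so the projection of
  \<open>x\<close> only gains its component along \<open>e\<close>.\<close>

lemma span_orthogonal_projection: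
  fixes x :: "'a::chilbert_space"
  assumes "finite B"
  shows "\<exists>p\<in>complex_vector.span B. \<forall>y\<in>complex_vector.span B. cinner (x - p) y = 0"
  using assms
proof (induction B arbitrary: x)
  case empty
  then show ?case using cinner_scaleC_right[of x 0 0] by simp
next
  case (insert b B)
  obtain q where q: "q \<in> complex_vector.span B" "\<And>y. y \<in> complex_vector.span B \<Longrightarrow> cinner (b - q) y = 0"
    using insert.IH[of b] by blast
  obtain p where p: "p \<in> complex_vector.span B" "\<And>y. y \<in> complex_vector.span B \<Longrightarrow> cinner (x - p) y = 0"
    using insert.IH[of x] by blast
  define e where "e = b - q"
  define c where "c = cinner x e / cinner e e"
  have sub: "complex_vector.span B \<subseteq> complex_vector.span (insert b B)"
    by (rule complex_vector.span_mono) auto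
  have e_span: "e \<in> complex_vector.span (insert b B)"
    unfolding e_def
  proof (rule complex_vector.span_diff)
    show "b \<in> complex_vector.span (insert b B)" by (rule complex_vector.span_base) simp
  qed (use q sub in blast)
  have pe: "cinner p e = 0"
    using q(2)[OF p(1)] cinner_commute[of p e] by (simp add: e_def)
  \<comment> \<open>If \<open>b\<close> already lies in the old span, then \<open>e = 0\<close>, and
    division by zero makes \<open>c = 0\<close>, so this case needs no separate
    construction.\<close>
  have ce: "c * cinner e e = cinner x e"
  proof (cases "e = 0")
    case True
    then show ?thesis using cinner_scaleC_right[of x 0 0] by simp
  next
    case False
    then have "cinner e e \<noteq> 0" by (simp add: cinner_same)
    then show ?thesis by (simp add: c_def)
  qed
  have "cinner (x - (p + c *\<^sub>C e)) y = 0" if y: "y \<in> complex_vector.span (insert b B)" for y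
  proof -
    obtain k where k: "y - k *\<^sub>C b \<in> complex_vector.span B"
      using y by (auto simp: complex_vector.span_insert)
    define z where "z = (y - k *\<^sub>C b) + k *\<^sub>C q"
    have z: "z \<in> complex_vector.span B"
      unfolding z_def using k q by (intro complex_vector.span_add complex_vector.span_scale)
    have y_eq: "y = k *\<^sub>C e + z"
      by (simp add: z_def e_def complex_vector.scale_right_diff_distrib)
    have "cinner (x - (p + c *\<^sub>C e)) e = 0"
      by (simp add: cinner_diff_left cinner_add_left cinner_scaleC_left pe ce)
    moreover have "cinner (x - (p + c *\<^sub>C e)) z = 0"
      using p(2)[OF z] q(2)[OF z]
      by (simp add: cinner_diff_left cinner_add_left cinner_scaleC_left e_def)
    ultimately show ?thesis
      by (simp add: y_eq cinner_add_right cinner_scaleC_right)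
  qed
  moreover have "p + c *\<^sub>C e \<in> complex_vector.span (insert b B)"
    using p sub e_span by (intro complex_vector.span_add complex_vector.span_scale) auto
  ultimately show ?case by blast
qed

text \<open>Linearity comes from uniqueness: two candidates differ by a vector that lies in
  \<open>V\<close> and is orthogonal to \<open>V\<close>. The minimality of the distance is
  Pythagoras.\<close>

lemma orthogonal_projection_linear:
  fixes V :: "'a::chilbert_space set"
  assumes V: "complex_vector.subspace V" and B: "finite B" "complex_vector.span B = V"
  obtains P where "Vector_Spaces.linear scaleC scaleC P" "\<And>x. P x \<in> V"
    "\<And>x v. v \<in> V \<Longrightarrow> norm (x - P x) \<le> norm (x - v)"
proof -
  have "\<exists>p\<in>V. \<forall>y\<in>V. cinner (x - p) y = 0" for x
    using span_orthogonal_projection[OF B(1)] B(2) by simp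
  then obtain P where P: "\<And>x. P x \<in> V" "\<And>x y. y \<in> V \<Longrightarrow> cinner (x - P x) y = 0"
    by metis
  have uniq: "P x = p" if p: "p \<in> V" "\<And>y. y \<in> V \<Longrightarrow> cinner (x - p) y = 0" for x p
  proof -
    have d: "P x - p \<in> V" using P p V by (simp add: complex_vector.subspace_diff)
    have "P x - p = (x - p) - (x - P x)" by simp
    then have "cinner (P x - p) (P x - p) = 0"
      using P(2)[OF d, of x] p(2)[OF d] by (metis cinner_diff_left diff_zero)
    then show ?thesis by (simp add: cinner_same)
  qed
  show thesis
  proof
    show "Vector_Spaces.linear scaleC scaleC P"
    proof unfold_locales
      fix x y
      show "P (x + y) = P x + P y"
      proof (rule uniq)
        show "P x + P y \<in> V" using P V by (simp add: complex_vector.subspace_add)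
        show "cinner (x + y - (P x + P y)) z = 0" if "z \<in> V" for z
          using P(2)[OF that, of x] P(2)[OF that, of y]
          by (simp add: cinner_diff_left cinner_add_left)
      qed
    next
      fix c x
      show "P (c *\<^sub>C x) = c *\<^sub>C P x"
      proof (rule uniq)
        show "c *\<^sub>C P x \<in> V" using P V by (simp add: complex_vector.subspace_scale)
        show "cinner (c *\<^sub>C x - c *\<^sub>C P x) z = 0" if "z \<in> V" for z
          using P(2)[OF that, of x]
          by (simp add: cinner_diff_left cinner_scaleC_left)
      qed
    qed
  next
    fix x v assume v: "v \<in> V"
    have d: "P x - v \<in> V" using P v V by (simp add: complex_vector.subspace_diff)
    have "inner (x - P x) (P x - v) = 0"
      using P(2)[OF d, of x] by (simp add: inner_eq_Re_cinner)
    then have "(norm (x - v))\<^sup>2 = (norm (x - P x))\<^sup>2 + (norm (P x - v))\<^sup>2"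
      using norm_add_Pythagorean[of "x - P x" "P x - v"] by (simp add: orthogonal_def)
    then have "(norm (x - P x))\<^sup>2 \<le> (norm (x - v))\<^sup>2" by simp
    then show "norm (x - P x) \<le> norm (x - v)" by (rule power2_le_imp_le) simp
  qed (use P in auto)
qed

text \<open>An infinite basis has \<open>card\<close> 0, so positive dimension forces
  finiteness.\<close>

lemma dim_pos_finite_basis:
  fixes V :: "'a::chilbert_space set"
  assumes "complex_vector.dim V > 0" "complex_vector.subspace V"
  obtains B where "finite B" "complex_vector.independent B" "complex_vector.span B = V"
    "card B = complex_vector.dim V"
proof -
  obtain B where B: "B \<subseteq> V" "complex_vector.independent B" "V \<subseteq> complex_vector.span B"
    "card B = complex_vector.dim V"
    using complex_vector.basis_exists by metis
  moreover have "complex_vector.span B = V"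
    using B assms(2) complex_vector.span_minimal by blast
  moreover have "finite B"
    using B assms(1) by (metis card.infinite less_numeral_extra(3))
  ultimately show thesis using that by blast
qed

text \<open>The projection onto \<open>V\<close> moves each \<open>x\<close> in \<open>W\<close> by
  at most \<open>d * norm x\<close>. As \<open>d < 1\<close> it is injective on \<open>W\<close>, so
  equality of dimensions makes it map \<open>W\<close> onto \<open>V\<close>; the required
  \<open>x\<close> is the preimage of \<open>h\<close>.\<close>

lemma subspace_gap_symmetric:
  fixes V W :: "'a::chilbert_space set"
  assumes V: "complex_vector.subspace V" and W: "complex_vector.subspace W"
    and dim: "complex_vector.dim V = complex_vector.dim W" "complex_vector.dim V > 0"
    and d: "d < 1"
    and gap: "\<And>x. x \<in> W \<Longrightarrow> \<exists>v\<in>V. norm (x - v) \<le> d * norm x"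
    and h: "h \<in> V"
  shows "\<exists>x\<in>W. norm (x - h) \<le> d * norm x"
proof -
  interpret vector_space_pair "scaleC :: complex \<Rightarrow> 'a \<Rightarrow> 'a" "scaleC :: complex \<Rightarrow> 'a \<Rightarrow> 'a" ..
  obtain A where A: "finite A" "complex_vector.span A = V" "card A = complex_vector.dim V"
    using dim_pos_finite_basis[OF dim(2) V] by metis
  obtain B where B: "finite B" "complex_vector.independent B" "complex_vector.span B = W"
    "card B = complex_vector.dim V"
    using dim_pos_finite_basis[OF _ W] dim by metis
  obtain P where P: "Vector_Spaces.linear scaleC scaleC P" "\<And>x. P x \<in> V"
    "\<And>x v. v \<in> V \<Longrightarrow> norm (x - P x) \<le> norm (x - v)"
    using orthogonal_projection_linear[OF V A(1,2)] by metis
  have close: "norm (x - P x) \<le> d * norm x" if x: "x \<in> W" for x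
    using gap[OF x] P(3) by (meson order_trans)
  have inj: "inj_on P W"
  proof (rule inj_onI)
    fix x y assume xy: "x \<in> W" "y \<in> W" "P x = P y"
    then have z: "x - y \<in> W" using W by (simp add: complex_vector.subspace_diff)
    have "P (x - y) = 0" using linear_diff[OF P(1)] xy by simp
    then have "norm (x - y) \<le> d * norm (x - y)" using close[OF z] by simp
    then have "(1 - d) * norm (x - y) \<le> 0" by (simp add: algebra_simps)
    then show "x = y" using d by (simp add: mult_le_0_iff)
  qed
  have ind: "complex_vector.independent (P ` B)"
    using linear_independent_injective_image[OF P(1) B(2)] inj B(3) by simp
  have card: "card (P ` B) = card A"
    using inj A B complex_vector.span_superset[of B] by (metis card_image inj_on_subset)
  have "h \<in> complex_vector.span (P ` B)"
  proof (rule ccontr)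
    assume nh: "h \<notin> complex_vector.span (P ` B)"
    then have "complex_vector.independent (insert h (P ` B))"
      using ind by (simp add: complex_vector.independent_insert)
    moreover have "insert h (P ` B) \<subseteq> complex_vector.span A"
      using h P(2) A by auto
    ultimately have "card (insert h (P ` B)) \<le> card A"
      using complex_vector.independent_span_bound[OF A(1)] by blast
    moreover have "h \<notin> P ` B" using nh complex_vector.span_base[of h "P ` B"] by argo
    ultimately show False using card B(1) by simp
  qed
  also have "complex_vector.span (P ` B) = P ` W"
    using linear_span_image[OF P(1), of B] B(3) by simp
  finally show ?thesis using close by auto
qed


section \<open>Joint eigenspaces and their lower semicontinuity\<close>

lemma subspace_tuple_kernel:
  assumes "commuting_tuple T"
  shows "complex_vector.subspace (tuple_kernel T w)"
proof (rule complex_vector.subspaceI)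
  have T: "bounded_linear (T i)" "T i (c *\<^sub>C x) = c *\<^sub>C T i x" for i c x
    using assms by (auto simp: commuting_tuple_def bounded_clinear_def)
  note lin = bounded_linear.linear[OF T(1)]
  show "0 \<in> tuple_kernel T w"
    by (simp add: tuple_kernel_eq linear_0[OF lin])
  show "x + y \<in> tuple_kernel T w" if "x \<in> tuple_kernel T w" "y \<in> tuple_kernel T w" for x y
    using that by (simp add: tuple_kernel_eq linear_add[OF lin] scaleC_add_right)
  show "c *\<^sub>C x \<in> tuple_kernel T w" if "x \<in> tuple_kernel T w" for c x
    using that by (simp add: tuple_kernel_eq T(2) scaleC_scaleC mult.commute)
qed

lemma tuple_kernelD: "h \<in> tuple_kernel T w \<Longrightarrow> T i h = (w $ i) *\<^sub>C h"
  by (simp add: tuple_kernel_eq)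

lemma bounded_linear_tuple_map:
  fixes T :: "'m::finite \<Rightarrow> 'a::chilbert_space \<Rightarrow> 'a"
  assumes "commuting_tuple T"
  shows "bounded_linear (tuple_map T w)"
proof -
  have comp: "bounded_linear (\<lambda>x. T i x - (w $ i) *\<^sub>C x)" for i
    using assms by (auto simp: commuting_tuple_def bounded_clinear_def
        intro!: bounded_linear_sub bounded_linear_scaleC)
  have nth: "tuple_map T w x $ i = T i x - (w $ i) *\<^sub>C x" for x i
    by (simp add: tuple_map_def)
  show ?thesis
  proof (rule bounded_linear_intro)
    show "tuple_map T w (x + y) = tuple_map T w x + tuple_map T w y" for x y
      using linear_add[OF bounded_linear.linear[OF comp]] by (simp add: vec_eq_iff nth)
    show "tuple_map T w (r *\<^sub>R x) = r *\<^sub>R tuple_map T w x" for r x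
      using linear_scale[OF bounded_linear.linear[OF comp]] by (simp add: vec_eq_iff nth)
    show "norm (tuple_map T w x) \<le> norm x * (\<Sum>i\<in>UNIV. onorm (\<lambda>x. T i x - (w $ i) *\<^sub>C x))" for x
    proof -
      have "norm (tuple_map T w x) \<le> (\<Sum>i\<in>UNIV. norm (T i x - (w $ i) *\<^sub>C x))"
        unfolding norm_vec_def nth by (rule L2_set_le_sum) simp
      also have "\<dots> \<le> (\<Sum>i\<in>UNIV. onorm (\<lambda>x. T i x - (w $ i) *\<^sub>C x) * norm x)"
        by (intro sum_mono onorm comp)
      finally show ?thesis by (simp add: sum_distrib_left mult.commute)
    qed
  qed
qed

text \<open>On a joint eigenspace each component of the map is multiplication by a difference of
  eigenvalues. This smallness is what the open mapping bound is applied to.\<close>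

lemma norm_tuple_map_kernel:
  assumes "x \<in> tuple_kernel T w"
  shows "norm (tuple_map T w0 x) = norm (w - w0) * norm x"
proof -
  have "tuple_map T w0 x $ i = (w $ i - w0 $ i) *\<^sub>C x" for i
    using tuple_kernelD[OF assms, of i]
    by (simp add: tuple_map_def complex_vector.scale_left_diff_distrib)
  then show ?thesis
    by (simp add: norm_vec_def norm_scaleC L2_set_left_distrib)
qed

text \<open>The open mapping bound puts \<open>ker (T - w)\<close> close to
  \<open>ker (T - w0)\<close>; the constant dimension lets \<open>subspace_gap_symmetric\<close>
  reverse this.\<close>

lemma tuple_kernel_lower_semicontinuous:
  fixes T :: "'m::finite \<Rightarrow> 'a::chilbert_space \<Rightarrow> 'a"
  assumes T: "commuting_tuple T" and cl: "closed (range (tuple_map T w0))"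
    and dim: "complex_vector.dim (tuple_kernel T w0) > 0"
      "\<forall>\<^sub>F w in nhds w0. complex_vector.dim (tuple_kernel T w) = complex_vector.dim (tuple_kernel T w0)"
    and h: "h \<in> tuple_kernel T w0" and e: "e > 0"
  shows "\<forall>\<^sub>F w in nhds w0. \<exists>x\<in>tuple_kernel T w. norm (x - h) < e"
proof -
  obtain C where C: "C > 0"
    "\<And>x. \<exists>u. tuple_map T w0 u = tuple_map T w0 x \<and> norm u \<le> C * norm (tuple_map T w0 x)"
    using open_mapping_closed_range[OF bounded_linear_tuple_map[OF T] cl] by blast
  \<comment> \<open>The bound 1/2 gives \<open>norm x \<le> 2 * norm h\<close> for the vector
    \<open>x\<close> found below; the other one then makes \<open>d * norm x\<close> smaller than
    \<open>e\<close>. Adding 1 covers \<open>h = 0\<close>.\<close>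
  define b where "b = min (1/2) (e / (2 * (norm h + 1)))"
  have b: "b > 0" using e by (auto simp: b_def intro!: divide_pos_pos add_nonneg_pos)
  have "((\<lambda>w. C * norm (w - w0)) \<longlongrightarrow> C * norm (w0 - w0)) (nhds w0)"
    by (intro tendsto_intros filterlim_ident)
  then have "\<forall>\<^sub>F w in nhds w0. C * norm (w - w0) < b"
    using b order_tendstoD(2)[where a = b] by simp
  with dim(2) show ?thesis
  proof eventually_elim
    case (elim w)
    define d where "d = C * norm (w - w0)"
    have d: "0 \<le> d" "d < 1/2" "d < e / (2 * (norm h + 1))"
      using elim C by (auto simp: d_def b_def)
    \<comment> \<open>Subtracting from \<open>x\<close> a small \<open>u\<close> with the same image
      under \<open>T - w0\<close> lands in the kernel at \<open>w0\<close>.\<close>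
    have gap: "\<exists>v\<in>tuple_kernel T w0. norm (x - v) \<le> d * norm x" if x: "x \<in> tuple_kernel T w" for x
    proof -
      obtain u where u: "tuple_map T w0 u = tuple_map T w0 x" "norm u \<le> C * norm (tuple_map T w0 x)"
        using C by blast
      have "x - u \<in> tuple_kernel T w0"
        using linear_diff[OF bounded_linear.linear[OF bounded_linear_tuple_map[OF T, of w0]], of x u] u
        by (simp add: tuple_kernel_def)
      moreover have "norm (x - (x - u)) \<le> d * norm x"
        using u norm_tuple_map_kernel[OF x, of w0] by (simp add: d_def)
      ultimately show ?thesis by blast
    qed
    obtain x where x: "x \<in> tuple_kernel T w" "norm (x - h) \<le> d * norm x"
      using subspace_gap_symmetric[OF subspace_tuple_kernel[OF T] subspace_tuple_kernel[OF T],
          of w0 w d h] gap elim dim(1) d h by auto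
    have "d * norm x \<le> 1/2 * norm x" using d by (intro mult_right_mono) auto
    moreover have "norm x \<le> norm h + norm (x - h)" by (rule norm_triangle_sub)
    ultimately have "norm x \<le> 2 * norm h" using x by linarith
    then have "norm (x - h) \<le> d * (2 * norm h)"
      using x d by (meson mult_left_mono order_trans)
    also have "\<dots> \<le> d * (2 * (norm h + 1))" using d by (intro mult_left_mono) auto
    also have "\<dots> < e"
    proof -
      have "2 * (norm h + 1) > 0" by (simp add: add_nonneg_pos)
      then show ?thesis using d(3) by (simp only: pos_less_divide_eq)
    qed
    finally show ?case using x by blast
  qed
qed

section \<open>Separating finitely many eigenvalues, and a rapidly convergent series\<close>

text \<open>\<open>R\<close> is a Lagrange interpolation polynomial in \<open>T\<close>. The last
  clause, preservation of every invariant subspace, stands in for being a polynomial in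
  \<open>T\<close>.\<close>

lemma tuple_kernel_interpolation:
  fixes T :: "'m::finite \<Rightarrow> 'a::chilbert_space \<Rightarrow> 'a"
  assumes T: "commuting_tuple T" and "finite J" "w \<notin> J"
  shows "\<exists>R. bounded_linear R \<and> (\<forall>v\<in>tuple_kernel T w. R v = v) \<and>
    (\<forall>u\<in>J. \<forall>v\<in>tuple_kernel T u. R v = 0) \<and>
    (\<forall>L. complex_vector.subspace L \<longrightarrow> (\<forall>i. T i ` L \<subseteq> L) \<longrightarrow> R ` L \<subseteq> L)"
  using assms(2,3)
proof (induction J)
  case empty
  then show ?case by (intro exI[of _ "\<lambda>x. x"]) (auto intro: bounded_linear_ident)
next
  case (insert u J)
  then obtain R where R: "bounded_linear R" "\<And>v. v \<in> tuple_kernel T w \<Longrightarrow> R v = v"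
    "\<And>u v. u \<in> J \<Longrightarrow> v \<in> tuple_kernel T u \<Longrightarrow> R v = 0"
    "\<And>L. complex_vector.subspace L \<Longrightarrow> (\<And>i. T i ` L \<subseteq> L) \<Longrightarrow> R ` L \<subseteq> L"
    by auto
  obtain i where i: "w $ i \<noteq> u $ i" using insert.prems by (auto simp: vec_eq_iff)
  \<comment> \<open>The Lagrange factor in a coordinate where \<open>w\<close> and \<open>u\<close>
    differ: it is 1 at \<open>w\<close>, 0 at \<open>u\<close>, and a scalar on every other joint
    eigenspace, so the vectors killed by \<open>R\<close> stay killed.\<close>
  define S where "S x = inverse (w $ i - u $ i) *\<^sub>C (T i x - (u $ i) *\<^sub>C x)" for x
  have Sker: "S v = (inverse (w $ i - u $ i) * (z $ i - u $ i)) *\<^sub>C v"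
    if "v \<in> tuple_kernel T z" for v z
    using tuple_kernelD[OF that, of i]
    by (simp add: S_def complex_vector.scale_left_diff_distrib[symmetric] scaleC_scaleC)
  show ?case
  proof (intro exI[of _ "\<lambda>x. R (S x)"] conjI ballI allI impI)
    have "bounded_linear (T i)"
      using T by (auto simp: commuting_tuple_def bounded_clinear_def)
    then have "bounded_linear S"
      unfolding S_def
      by (intro bounded_linear_compose[OF bounded_linear_scaleC] bounded_linear_sub bounded_linear_scaleC)
    then show "bounded_linear (\<lambda>x. R (S x))"
      by (rule bounded_linear_compose[OF R(1)])
    show "R (S v) = v" if "v \<in> tuple_kernel T w" for v
      using Sker[OF that] i R(2)[OF that] by simp
    show "R (S v) = 0" if z: "z \<in> insert u J" and v: "v \<in> tuple_kernel T z" for z v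
    proof (cases "z = u")
      case True
      then show ?thesis
        using Sker[OF v] linear_0[OF bounded_linear.linear[OF R(1)]] by simp
    next
      case False
      then show ?thesis
        using z v R(3) Sker[OF v] complex_vector.subspace_scale[OF subspace_tuple_kernel[OF T] v]
        by auto
    qed
    show "(\<lambda>x. R (S x)) ` L \<subseteq> L" if L: "complex_vector.subspace L" "\<forall>i. T i ` L \<subseteq> L" for L
    proof -
      have "S x \<in> L" if "x \<in> L" for x
        using L that unfolding S_def
        by (intro complex_vector.subspace_scale complex_vector.subspace_diff) auto
      then show ?thesis using R(4)[OF L(1)] L(2) by blast
    qed
  qed
qed

text \<open>
  The coefficient \<open>c j\<close> is chosen against the norms of the finitely many \<open>R k N\<close> with \<open>k, N \<le> j\<close>, which bounds all tails at once.
\<close>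

lemma separating_series:
  fixes e :: "nat \<Rightarrow> 'a::banach" and R :: "nat \<Rightarrow> nat \<Rightarrow> 'a \<Rightarrow> 'a"
  assumes R: "\<And>k N. bounded_linear (R k N)"
    and fix_: "\<And>k N. R k N (e k) = e k"
    and kill: "\<And>k N j. j \<le> N \<Longrightarrow> j \<noteq> k \<Longrightarrow> R k N (e j) = 0"
  obtains f c where "\<And>k. c k > 0" "\<And>k. (\<lambda>N. R k N f) \<longlonglongrightarrow> c k *\<^sub>R e k"
proof -
  define M where "M j = 1 + (\<Sum>k\<le>j. \<Sum>N\<le>j. onorm (R k N))" for j
  \<comment> \<open>The term 1 beside \<open>norm (e j)\<close> allows for \<open>e j = 0\<close>,
    which can occur in the application.\<close>
  define c where "c j = (1/2) ^ j / (M j * (1 + norm (e j)))" for j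
  have on: "onorm (R k N) \<ge> 0" for k N by (rule onorm_pos_le[OF R])
  have M: "M j \<ge> 1" for j unfolding M_def by (simp add: sum_nonneg on)
  have RM: "onorm (R k N) \<le> M j" if "k \<le> j" "N \<le> j" for k N j
  proof -
    have "onorm (R k N) \<le> (\<Sum>N\<le>j. onorm (R k N))"
      using that by (intro member_le_sum) (auto simp: on)
    also have "\<dots> \<le> (\<Sum>k\<le>j. \<Sum>N\<le>j. onorm (R k N))"
      using that by (intro member_le_sum[where f = "\<lambda>k. \<Sum>N\<le>j. onorm (R k N)"]) (auto simp: on sum_nonneg)
    finally show ?thesis by (simp add: M_def)
  qed
  have pos: "M j * (1 + norm (e j)) > 0" for j
    using M[of j] by (intro mult_pos_pos) (auto simp: add_pos_nonneg)
  have c: "c j > 0" for j using pos[of j] by (simp add: c_def)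
  have Mc: "M j * norm (c j *\<^sub>R e j) \<le> (1/2) ^ j" for j
  proof -
    have "M j * norm (c j *\<^sub>R e j) = (1/2) ^ j * (norm (e j) / (1 + norm (e j)))"
      using M[of j] c[of j] pos[of j] by (simp add: c_def)
    also have "\<dots> \<le> (1/2) ^ j * 1"
      by (intro mult_left_mono) (auto simp: divide_simps add_pos_nonneg)
    finally show ?thesis by simp
  qed
  have geo: "(\<lambda>j. (1/2::real) ^ j) sums 2"
    using geometric_sums[of "1/2::real"] by simp
  have small: "norm (c j *\<^sub>R e j) \<le> (1/2) ^ j" for j
    using mult_right_mono[OF M[of j] norm_ge_zero[of "c j *\<^sub>R e j"]] Mc[of j] by simp
  define f where "f = (\<Sum>j. c j *\<^sub>R e j)"
  have "summable (\<lambda>j. c j *\<^sub>R e j)"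
    by (rule summable_comparison_test'[OF sums_summable[OF geo]]) (rule small)
  then have f: "(\<lambda>j. c j *\<^sub>R e j) sums f" unfolding f_def by (rule summable_sums)
  show thesis
  proof
    fix k
    \<comment> \<open>Of the terms up to \<open>N\<close> only the \<open>k\<close>-th survives. In
      the tail \<open>j > N \<ge> k\<close>, so \<open>M j\<close> dominates the norm of
      \<open>R k N\<close>, and the powers of 1/2 from \<open>Suc N\<close> on sum to
      \<open>(1/2) ^ N\<close>.\<close>
    have bound: "norm (R k N f - c k *\<^sub>R e k) \<le> (1/2) ^ N" if N: "N \<ge> k" for N
    proof -
      interpret R: bounded_linear "R k N" by (rule R)
      have *: "R k N (c j *\<^sub>R e j) = (if j = k then c k *\<^sub>R e k else 0)" if "j \<le> N" for j
        using that fix_ kill by (auto simp: R.scaleR)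
      have "(\<Sum>j<Suc N. R k N (c j *\<^sub>R e j)) = (\<Sum>j<Suc N. if j = k then c k *\<^sub>R e k else 0)"
        by (intro sum.cong) (auto simp: *)
      also have "\<dots> = c k *\<^sub>R e k" using N by simp
      finally have head: "(\<Sum>j<Suc N. R k N (c j *\<^sub>R e j)) = c k *\<^sub>R e k" .
      have tail: "(\<lambda>i. R k N (c (i + Suc N) *\<^sub>R e (i + Suc N))) sums (R k N f - c k *\<^sub>R e k)"
        using sums_split_initial_segment[OF R.sums[OF f], of "Suc N"] head by simp
      have "(\<lambda>i. (1/2) ^ Suc N * (1/2::real) ^ i) sums ((1/2) ^ Suc N * 2)"
        by (intro sums_mult geo)
      then have "norm (R k N f - c k *\<^sub>R e k) \<le> (1/2) ^ Suc N * 2"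
      proof (rule norm_sums_le[OF tail])
        fix i
        let ?j = "i + Suc N"
        have "norm (R k N (c ?j *\<^sub>R e ?j)) \<le> onorm (R k N) * norm (c ?j *\<^sub>R e ?j)"
          by (rule onorm[OF R])
        also have "\<dots> \<le> M ?j * norm (c ?j *\<^sub>R e ?j)"
          using N by (intro mult_right_mono RM) auto
        also have "\<dots> \<le> (1/2) ^ ?j" by (rule Mc)
        finally show "norm (R k N (c ?j *\<^sub>R e ?j)) \<le> (1/2) ^ Suc N * (1/2) ^ i"
          by (simp add: power_add mult.commute)
      qed
      then show ?thesis by simp
    qed
    have "(\<lambda>N. R k N f - c k *\<^sub>R e k) \<longlonglongrightarrow> 0"
    proof (rule Lim_null_comparison)
      show "\<forall>\<^sub>F N in sequentially. norm (R k N f - c k *\<^sub>R e k) \<le> (1/2) ^ N"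
        using bound by (auto simp: eventually_sequentially)
      show "(\<lambda>N. (1/2::real) ^ N) \<longlonglongrightarrow> 0" by (rule LIMSEQ_realpow_zero) auto
    qed
    then show "(\<lambda>N. R k N f) \<longlonglongrightarrow> c k *\<^sub>R e k" by (simp add: LIM_zero_iff)
  qed (use c in simp)
qed

section \<open>Distinct eigenvalues and invariance of the cyclic subspace\<close>

lemma injective_choice:
  fixes W :: "nat \<Rightarrow> 'b set"
  assumes "\<And>k. infinite (W k)"
  obtains w where "\<And>k. w k \<in> W k" "inj w"
proof -
  have "\<exists>w. \<forall>k. w k \<in> W k \<and> (\<forall>j<k. w j \<noteq> w k)"
  proof (rule dependent_wellorder_choice)
    fix k :: nat and w :: "nat \<Rightarrow> 'b"
    have "infinite (W k - w ` {..<k})" using assms by simp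
    then obtain x where "x \<in> W k - w ` {..<k}" by (metis ex_in_conv finite.emptyI)
    then show "\<exists>x. x \<in> W k \<and> (\<forall>j<k. w j \<noteq> x)" by auto
  qed auto
  then show thesis
    using that by (metis injI linorder_neqE_nat)
qed

lemma subspace_closure:
  fixes L :: "'a::chilbert_space set"
  assumes "complex_vector.subspace L"
  shows "complex_vector.subspace (closure L)"
proof (rule complex_vector.subspaceI)
  show "0 \<in> closure L"
    using complex_vector.subspace_0[OF assms] closure_subset by (rule rev_subsetD)
  show "x + y \<in> closure L" if x: "x \<in> closure L" and y: "y \<in> closure L" for x y
  proof -
    obtain a where "\<And>n. a n \<in> L" "a \<longlonglongrightarrow> x"
      using x unfolding closure_sequential by auto
    moreover obtain b where "\<And>n. b n \<in> L" "b \<longlonglongrightarrow> y"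
      using y unfolding closure_sequential by auto
    ultimately show ?thesis
      unfolding closure_sequential using assms
      by (intro exI[of _ "\<lambda>n. a n + b n"]) (auto intro: tendsto_add complex_vector.subspace_add)
  qed
  show "c *\<^sub>C x \<in> closure L" if "x \<in> closure L" for c x
  proof -
    have "(*\<^sub>C) c ` closure L \<subseteq> closure ((*\<^sub>C) c ` L)"
      by (intro closure_bounded_linear_image_subset bounded_linear_scaleC)
    also have "\<dots> \<subseteq> closure L"
      using assms by (intro closure_mono) (auto intro: complex_vector.subspace_scale)
    finally show ?thesis using that by blast
  qed
qed

text \<open>Applying \<open>T i\<close> raises one exponent, so generators go to generators;
  linearity and continuity carry this to the closed span.\<close>

lemma cyclic_subspace_invariant:
  fixes T :: "'m::finite \<Rightarrow> 'a::chilbert_space \<Rightarrow> 'a"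
  assumes T: "commuting_tuple T"
  shows "T i ` closure (complex_vector.span (range (\<lambda>\<alpha>. tuple_power T \<alpha> f)))
    \<subseteq> closure (complex_vector.span (range (\<lambda>\<alpha>. tuple_power T \<alpha> f)))"
proof -
  let ?G = "range (\<lambda>\<alpha>. tuple_power T \<alpha> f)"
  have bl: "bounded_linear (T i)" and sc: "\<And>c x. T i (c *\<^sub>C x) = c *\<^sub>C T i x"
    using T by (auto simp: commuting_tuple_def bounded_clinear_def)
  have lin: "Vector_Spaces.linear scaleC scaleC (T i)"
    by unfold_locales (auto simp: sc linear_add[OF bounded_linear.linear[OF bl]])
  interpret vector_space_pair "scaleC :: complex \<Rightarrow> 'a \<Rightarrow> 'a" "scaleC :: complex \<Rightarrow> 'a \<Rightarrow> 'a" ..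
  have "T i (tuple_power T \<alpha> f) \<in> ?G" for \<alpha>
    by (metis tuple_power_upd[OF T] rangeI)
  then have "T i ` ?G \<subseteq> ?G" by blast
  then have "T i ` complex_vector.span ?G \<subseteq> complex_vector.span ?G"
    unfolding linear_span_image[OF lin, symmetric] by (rule complex_vector.span_mono)
  then show ?thesis
    by (meson closure_bounded_linear_image_subset[OF bl] closure_mono order_trans)
qed

section \<open>Construction of the cyclic vector\<close>

theorem theorem2p4:
  fixes n :: nat
    and \<Omega> :: "(complex ^ 'm::finite) set"
    and T :: "'m \<Rightarrow> 'a::chilbert_space \<Rightarrow> 'a"
  assumes "n \<ge> 1"
    and "open \<Omega>" and "connected \<Omega>"
    and "separable_space (euclidean :: 'a topology)"
    and "cowen_douglas n \<Omega> T"
  shows "cyclic_tuple T"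
proof -
  have T: "commuting_tuple T"
    and cl: "\<And>w. w \<in> \<Omega> \<Longrightarrow> closed (range (tuple_map T w))"
    and dim: "\<And>w. w \<in> \<Omega> \<Longrightarrow> complex_vector.dim (tuple_kernel T w) = n"
    and total: "closure (complex_vector.span (\<Union>w\<in>\<Omega>. tuple_kernel T w)) = UNIV"
    using assms(5) by (auto simp: cowen_douglas_def)
  show ?thesis
  proof (cases "\<Omega> = {}")
    \<comment> \<open>With no eigenvectors at all, totality forces the space to be zero.\<close>
    case True
    with total have "x \<in> {0}" for x :: 'a
      using UNIV_I[of x] by simp
    moreover have "0 \<in> closure (complex_vector.span (range (\<lambda>\<alpha>. tuple_power T \<alpha> 0)))"
      using closure_subset complex_vector.span_zero by blast
    ultimately have "closure (complex_vector.span (range (\<lambda>\<alpha>. tuple_power T \<alpha> 0))) = UNIV"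
      by (metis UNIV_eq_I singletonD)
    then show ?thesis unfolding cyclic_tuple_def by (rule exI)
  next
    case False
    obtain D :: "'a set" where D: "countable D" "closure D = UNIV"
      using assms(4) by (auto simp: separable_space_def)
    then have "D \<noteq> {}" by auto
    \<comment> \<open>The balls \<open>B k\<close> run through all \<open>ball z (1 / (b + 1))\<close> with \<open>z \<in> D\<close>; if \<open>B k\<close> contains no
      joint eigenvector, any unused eigenvalue will do, with eigenvector 0.\<close>
    define B where "B k = ball (from_nat_into D (fst (prod_decode k))) (1 / Suc (snd (prod_decode k)))" for k
    define V where "V k = {w\<in>\<Omega>. tuple_kernel T w \<inter> B k \<noteq> {}}" for k
    define W where "W k = (if V k = {} then \<Omega> else V k)" for k
    \<comment> \<open>An eigenvector inside the open ball \<open>B k\<close> persists, by lower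
      semicontinuity, at all nearby eigenvalues.\<close>
    have openV: "open (V k)" for k
    proof (subst open_subopen, intro ballI)
      fix w0 assume "w0 \<in> V k"
      then obtain h where w0: "w0 \<in> \<Omega>" and h: "h \<in> tuple_kernel T w0" "h \<in> B k"
        by (auto simp: V_def)
      have "open (B k)" by (simp add: B_def)
      then obtain r where r: "r > 0" "ball h r \<subseteq> B k"
        using h(2) by (rule openE)
      have nhd: "\<forall>\<^sub>F w in nhds w0. w \<in> \<Omega>"
        using assms(2) w0 by (rule eventually_nhds_in_open)
      have "\<forall>\<^sub>F w in nhds w0. \<exists>x\<in>tuple_kernel T w. norm (x - h) < r"
      proof (rule tuple_kernel_lower_semicontinuous[OF T cl[OF w0] _ _ h(1) r(1)])
        show "complex_vector.dim (tuple_kernel T w0) > 0" using dim[OF w0] assms(1) by simp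
        show "\<forall>\<^sub>F w in nhds w0.
            complex_vector.dim (tuple_kernel T w) = complex_vector.dim (tuple_kernel T w0)"
          using nhd by eventually_elim (simp add: dim w0)
      qed
      with nhd have "\<forall>\<^sub>F w in nhds w0. w \<in> V k"
      proof eventually_elim
        case (elim w)
        then obtain x where x: "x \<in> tuple_kernel T w" "norm (x - h) < r" by blast
        then have "x \<in> B k" using r(2) by (auto simp: dist_norm norm_minus_commute)
        then show ?case using elim x by (auto simp: V_def)
      qed
      then show "\<exists>S. open S \<and> w0 \<in> S \<and> S \<subseteq> V k"
        unfolding eventually_nhds by blast
    qed
    \<comment> \<open>Nonempty open sets here are infinite, which leaves room to choose pairwise
      distinct eigenvalues.\<close>
    have "infinite (W k)" for k
      using openV[of k] assms(2) False finite_imp_not_open by (auto simp: W_def)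
    then obtain w where w: "\<And>k. w k \<in> W k" "inj w" using injective_choice[of W] by blast
    have "\<exists>x\<in>tuple_kernel T (w k). V k \<noteq> {} \<longrightarrow> x \<in> B k" for k
    proof (cases "V k = {}")
      case True
      then show ?thesis
        using complex_vector.subspace_0[OF subspace_tuple_kernel[OF T]] by blast
    next
      case False
      then have "w k \<in> V k" using w(1)[of k] by (simp add: W_def)
      then show ?thesis by (auto simp: V_def)
    qed
    then obtain e where e: "\<And>k. e k \<in> tuple_kernel T (w k)" "\<And>k. V k \<noteq> {} \<Longrightarrow> e k \<in> B k"
      by metis
    define J where "J k N = w ` ({..N} - {k})" for k and N :: nat
    have "finite (J k N)" "w k \<notin> J k N" for k N
      using w(2) by (auto simp: J_def dest: injD)
    from tuple_kernel_interpolation[OF T this]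
    obtain R where R: "\<And>k N. bounded_linear (R k N)"
      "\<And>k N v. v \<in> tuple_kernel T (w k) \<Longrightarrow> R k N v = v"
      "\<And>k N u v. u \<in> J k N \<Longrightarrow> v \<in> tuple_kernel T u \<Longrightarrow> R k N v = 0"
      "\<And>k N L. complex_vector.subspace L \<Longrightarrow> \<forall>i. T i ` L \<subseteq> L \<Longrightarrow> R k N ` L \<subseteq> L"
      by metis
    have kill: "R k N (e j) = 0" if "j \<le> N" "j \<noteq> k" for k N j
      by (rule R(3)[OF _ e(1)]) (use that in \<open>auto simp: J_def\<close>)
    obtain f c where f: "\<And>k. c k > 0" "\<And>k. (\<lambda>N. R k N f) \<longlonglongrightarrow> c k *\<^sub>R e k"
    proof (rule separating_series[of R e])
      show "bounded_linear (R k N)" "R k N (e k) = e k" for k N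
        by (rule R(1), rule R(2)[OF e(1)])
    qed (use kill in auto)
    define L where "L = closure (complex_vector.span (range (\<lambda>\<alpha>. tuple_power T \<alpha> f)))"
    have closedL: "closed L" by (simp add: L_def)
    have subL: "complex_vector.subspace L"
      unfolding L_def by (intro subspace_closure complex_vector.subspace_span)
    have invL: "\<forall>i. T i ` L \<subseteq> L"
      unfolding L_def using cyclic_subspace_invariant[OF T] by blast
    have "f \<in> range (\<lambda>\<alpha>. tuple_power T \<alpha> f)"
      by (rule range_eqI[of _ _ "\<lambda>_. 0"]) simp
    then have "f \<in> L"
      unfolding L_def by (intro closure_subset[THEN subsetD] complex_vector.span_base)
    then have RL: "R k N f \<in> L" for k N using R(4)[OF subL invL] by blast
    \<comment> \<open>\<open>L\<close> is closed and contains all \<open>R k N f\<close>, hence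
      their limit \<open>c k *\<^sub>R e k\<close>; as \<open>c k > 0\<close>, the coefficient can
      be divided out.\<close>
    have eL: "e k \<in> L" for k
    proof -
      have "c k *\<^sub>R e k \<in> L"
        by (rule Lim_in_closed_set[OF _ _ _ f(2)]) (auto simp: RL closedL)
      then have "complex_of_real (inverse (c k)) *\<^sub>C c k *\<^sub>R e k \<in> L"
        by (rule complex_vector.subspace_scale[OF subL])
      then show ?thesis using f(1)[of k] by (simp only: scaleC_of_real) simp
    qed
    have "h \<in> L" if w0: "w0 \<in> \<Omega>" and h: "h \<in> tuple_kernel T w0" for w0 h
    proof -
      have "h \<in> closure L"
        unfolding closure_approachable
      proof (intro allI impI)
        fix \<epsilon> :: real assume "\<epsilon> > 0"
        \<comment> \<open>Half of \<epsilon>, because \<open>h\<close> and the chosen eigenvector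
          are compared through the common centre \<open>z\<close> of a ball containing both.\<close>
        then obtain b where b: "1 / Suc b < \<epsilon> / 2"
          using reals_Archimedean[of "\<epsilon> / 2"] by (auto simp: inverse_eq_divide)
        have "h \<in> closure D" using D by simp
        then obtain z where z: "z \<in> D" "dist z h < 1 / Suc b"
          unfolding closure_approachable by (metis of_nat_0_less_iff zero_less_Suc zero_less_divide_1_iff)
        obtain a where a: "from_nat_into D a = z"
          using from_nat_into_surj[OF D(1) z(1)] by blast
        let ?k = "prod_encode (a, b)"
        have Bk: "B ?k = ball z (1 / Suc b)" by (simp add: B_def a)
        then have "h \<in> B ?k" using z by simp
        then have "V ?k \<noteq> {}" using w0 h by (auto simp: V_def)
        then have "dist z (e ?k) < 1 / Suc b" using e(2)[of ?k] Bk by simp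
        then have "dist (e ?k) h < \<epsilon>"
          using z b dist_triangle2[of "e ?k" h z] dist_commute[of z h] dist_commute[of z "e ?k"]
          by linarith
        then show "\<exists>y\<in>L. dist y h < \<epsilon>" using eL by blast
      qed
      then show ?thesis by (simp add: L_def)
    qed
    then have "complex_vector.span (\<Union>w\<in>\<Omega>. tuple_kernel T w) \<subseteq> L"
      by (intro complex_vector.span_minimal[OF _ subL]) blast
    then have "closure (complex_vector.span (\<Union>w\<in>\<Omega>. tuple_kernel T w)) \<subseteq> L"
      by (rule closure_minimal) (simp add: L_def)
    then show ?thesis
      unfolding cyclic_tuple_def L_def using total by blast
  qed
qed

end
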